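(* Let $n\ge 0$ be an integer, let $\lambda$ be a nonzero complex number, let $P_n$ be the Legendre polynomial of degree $n$, and put $\widehat{P_n}(\lambda)=\int_{-1}^{1}P_n(x)e^{i\lambda x}\,dx$. Then $\widehat{P_n}(\lambda)$ is equal to each of the following four expressions: $$\widehat{P_n}(\lambda)=2^{n}\sum_{k=0}^{n}\binom{n}{k}\binom{\tfrac12(n+k-1)}{n}\frac{(-1)^k k!}{(i\lambda)^{k+1}}\left[e^{i\lambda}E_k(-i\lambda)-e^{-i\lambda}E_k(i\lambda)\right],$$ $$\widehat{P_n}(\lambda)=i^{n}\sqrt{\frac{2\pi}{\lambda}}\,J_{n+1/2}(\lambda),$$ $$\widehat{P_n}(\lambda)=2\sum_{k=0}^{n}\frac{(n+k)!}{(n-k)!\,k!}\,\frac{e^{-i\lambda}E_k(2i\lambda)-e^{i\lambda}}{(-2i\lambda)^{k+1}},$$ $$\widehat{P_n}(\lambda)=2\sum_{k=0}^{n}\frac{(n+k)!}{(n-k)!\,k!}\,\frac{(-1)^{n+k}e^{-i\lambda}-e^{i\lambda}}{(-2i\lambda)^{k+1}}.$$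
   Context: The Legendre polynomial is $P_n(x)=\frac{1}{2^n n!}\left(\frac{d}{dx}\right)^n(x^2-1)^n$. $E_k(x)=\sum_{j=0}^{k}\frac{x^j}{j!}$ denotes the $k$-th partial sum of the exponential series. For a real number $r$ and an integer $n\ge 0$, $\binom{r}{n}=\frac{r(r-1)\cdots(r-n+1)}{n!}$. The Bessel function is $J_\alpha(\lambda)=\sum_{k=0}^\infty\frac{(-1)^k(\lambda/2)^{2k+\alpha}}{k!\,\Gamma(k+\alpha+1)}$. In the second expression, $\sqrt{2\pi/\lambda}$ means $\sqrt{2\pi}/\lambda^{1/2}$, where the same choice of the square root $\lambda^{1/2}$ is used here and in $(\lambda/2)^{n+1/2}=\lambda^{n}\lambda^{1/2}/2^{n+1/2}$ inside $J_{n+1/2}(\lambda)$ (for $\lambda>0$ these are the usual positive roots). *)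

theory Defs
  imports "HOL-Analysis.Analysis" "HOL-Computational_Algebra.Polynomial"
begin

definition legendre_poly :: "nat \<Rightarrow> real poly" where
  "legendre_poly n = smult (1 / (2 ^ n * fact n)) ((pderiv ^^ n) ([:-1, 0, 1:] ^ n))"

definition legendre_hat :: "nat \<Rightarrow> complex \<Rightarrow> complex" where
  "legendre_hat n z =
     integral {-1..1} (\<lambda>x::real. complex_of_real (poly (legendre_poly n) x) * exp (\<i> * z * complex_of_real x))"

definition exp_partial :: "nat \<Rightarrow> complex \<Rightarrow> complex" where
  "exp_partial k x = (\<Sum>j=0..k. x ^ j / fact j)"

text \<open>
  The Bessel function of order \<open>\<alpha>\<close> at \<open>z\<close>. For non-integral \<open>\<alpha>\<close> it is multivalued through
  the factor \<open>(z/2)\<^sup>\<alpha>\<close>, so the value \<open>w\<close> chosen for \<open>(z/2)\<^sup>\<alpha>\<close> is an explicit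
  argument; \<open>(z/2)\<close> to the power \<open>2k + \<alpha>\<close> is then \<open>w (z/2)\<close> times the even
  integral power of order \<open>2k\<close>. The lemma below shows that the principal choice of \<open>w\<close> gives the
  usual series with the principal power.
\<close>

definition bessel_J_branch :: "complex \<Rightarrow> complex \<Rightarrow> complex \<Rightarrow> complex" where
  "bessel_J_branch w \<alpha> z =
     (\<Sum>k. (-1) ^ k * (w * (z / 2) ^ (2 * k)) / (fact k * Gamma (of_nat k + \<alpha> + 1)))"

lemma bessel_J_branch_principal:
  assumes "z \<noteq> 0"
  shows "bessel_J_branch ((z / 2) powr \<alpha>) \<alpha> z =
    (\<Sum>k. (-1) ^ k * (z / 2) powr (of_nat (2 * k) + \<alpha>) / (fact k * Gamma (of_nat k + \<alpha> + 1)))"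
proof -
  have "(z / 2) powr (of_nat (2 * k) + \<alpha>) = (z / 2) powr \<alpha> * (z / 2) ^ (2 * k)" for k
  proof -
    have "(z / 2) powr (of_nat (2 * k)) = (z / 2) ^ (2 * k)"
      using assms by (intro powr_nat') auto
    then show ?thesis by (simp only: powr_add mult.commute)
  qed
  then show ?thesis by (simp only: bessel_J_branch_def)
qed

text \<open>For \<open>\<alpha> = n + 1/2\<close>, with \<open>s\<close> a chosen square root of \<open>z\<close>, the value used for
  \<open>(z/2)\<^sup>\<alpha>\<close> is \<open>z\<^sup>n s\<close> divided by the positive real power of 2 of order \<open>n + 1/2\<close>.\<close>

definition bessel_J_half :: "nat \<Rightarrow> complex \<Rightarrow> complex \<Rightarrow> complex" where
  "bessel_J_half n s z =
     bessel_J_branch (z ^ n * s / complex_of_real (2 powr (real n + 1 / 2))) (of_nat n + 1 / 2) z"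

end

theory Submission imports Defs begin

text \<open>
  Put \<open>c = \<i> z\<close>. The integral of \<open>(x - b)\<^sup>k exp (c x)\<close> over \<open>[-1, 1]\<close> is elementary and produces
  the partial exponential sums; expanding \<open>P\<^sub>n\<close> around \<open>b = 0\<close> and around \<open>b = 1\<close> gives the first
  and third formulas. Repeated integration by parts, which differentiates \<open>P\<^sub>n\<close>, leaves only the
  derivatives of \<open>P\<^sub>n\<close> at \<open>1\<close> and \<open>-1\<close>, giving the fourth. For the Bessel formula, integrating the Rodrigues
  formula by parts \<open>n\<close> times turns the integral into a multiple of that of
  \<open>(1 - x\<^sup>2)\<^sup>n exp (c x)\<close>, whose power series in \<open>c\<close> has Beta integrals as coefficients.
\<close>

section \<open>Integrals of polynomials against an exponential\<close>

definition poly_exp_integral :: "complex \<Rightarrow> real poly \<Rightarrow> complex" where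
  "poly_exp_integral c p = integral {-1..1} (\<lambda>x. of_real (poly p x) * exp (c * of_real x))"

lemma poly_exp_integrable:
  fixes c :: complex
  shows "(\<lambda>x. of_real (poly p x) * exp (c * of_real x)) integrable_on {-1..1::real}"
  by (intro integrable_continuous_interval continuous_intros)

lemma poly_exp_integral_0 [simp]: "poly_exp_integral c 0 = 0"
  by (simp add: poly_exp_integral_def)

lemma poly_exp_integral_add:
  "poly_exp_integral c (p + q) = poly_exp_integral c p + poly_exp_integral c q"
  unfolding poly_exp_integral_def
  by (subst integral_add [symmetric]) (auto intro: poly_exp_integrable simp: algebra_simps)

lemma poly_exp_integral_smult:
  "poly_exp_integral c (smult a p) = of_real a * poly_exp_integral c p"
  unfolding poly_exp_integral_def
  by (subst integral_mult_right [symmetric]) (simp add: mult.assoc)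

lemma poly_exp_integral_sum:
  "poly_exp_integral c (\<Sum>i\<in>A. f i) = (\<Sum>i\<in>A. poly_exp_integral c (f i))"
  by (induction A rule: infinite_finite_induct) (auto simp: poly_exp_integral_add)

text \<open>The fundamental theorem applied to p(x) exp(c x). This one relation drives the moment
  recursion, the endpoint expansion and the transfer of derivatives in the Rodrigues
  formula.\<close>

lemma poly_exp_integral_parts:
  "poly_exp_integral c (pderiv p) =
     of_real (poly p 1) * exp c - of_real (poly p (-1)) * exp (- c) - c * poly_exp_integral c p"
proof -
  let ?e = "\<lambda>x::real. exp (c * of_real x)"
  let ?F = "\<lambda>x. of_real (poly p x) * ?e x"
  let ?f = "\<lambda>x. of_real (poly p x) * (c * ?e x) + of_real (poly (pderiv p) x) * ?e x"
  have e: "(?e has_vector_derivative c * ?e x) (at x within {-1..1})" for x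
    by (rule has_vector_derivative_real_field) (auto intro!: derivative_eq_intros)
  have "(?F has_vector_derivative ?f x) (at x within {-1..1})" for x
    by (intro has_vector_derivative_mult e has_vector_derivative_of_real
          DERIV_subset [OF poly_DERIV]) auto
  then have "(?f has_integral ?F 1 - ?F (-1)) {-1..1}"
    by (intro fundamental_theorem_of_calculus) auto
  moreover have "(?f has_integral c * poly_exp_integral c p + poly_exp_integral c (pderiv p)) {-1..1}"
  proof (rule has_integral_add)
    show "((\<lambda>x. of_real (poly p x) * (c * ?e x)) has_integral c * poly_exp_integral c p) {-1..1}"
      using has_integral_mult_right [OF integrable_integral [OF poly_exp_integrable [of p c]], of c]
      by (simp add: poly_exp_integral_def mult_ac)
  next
    show "((\<lambda>x. of_real (poly (pderiv p) x) * ?e x) has_integral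
            poly_exp_integral c (pderiv p)) {-1..1}"
      unfolding poly_exp_integral_def by (rule integrable_integral [OF poly_exp_integrable])
  qed
  ultimately have "c * poly_exp_integral c p + poly_exp_integral c (pderiv p) = ?F 1 - ?F (-1)"
    by (rule has_integral_unique [symmetric])
  then show ?thesis by (simp add: algebra_simps)
qed

lemma exp_partial_0 [simp]: "exp_partial 0 x = 1"
  by (simp add: exp_partial_def)

lemma exp_partial_Suc: "exp_partial (Suc k) x = exp_partial k x + x ^ Suc k / fact (Suc k)"
  by (simp add: exp_partial_def)

text \<open>Induction on k by parts: the derivative of (x - b)^(k+1) brings back the previous
  integral, and the boundary terms at 1 and -1 are exactly the summands that extend the two partial
  sums from order k to k + 1.\<close>

lemma poly_exp_integral_shifted_power:
  assumes "c \<noteq> 0"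
  shows "poly_exp_integral c ([:-b, 1:] ^ k) = (-1) ^ k * fact k / c ^ (k + 1) *
    (exp c * exp_partial k (- (c * of_real (1 - b))) - exp (- c) * exp_partial k (c * of_real (1 + b)))"
proof (induction k)
  case 0
  show ?case
    using poly_exp_integral_parts [of c 1] assms by (simp add: field_simps pderiv_1)
next
  case (Suc k)
  let ?q = "[:-b, 1:] ^ Suc k"
  have "pderiv ?q = smult (of_nat (Suc k)) ([:-b, 1:] ^ k)"
    by (simp only: pderiv_power_Suc) (simp add: pderiv_pCons)
  then have "of_nat (Suc k) * poly_exp_integral c ([:-b, 1:] ^ k) =
      of_real ((1 - b) ^ Suc k) * exp c - of_real ((- 1 - b) ^ Suc k) * exp (- c)
      - c * poly_exp_integral c ?q"
    using poly_exp_integral_parts [of c ?q] by (simp add: poly_exp_integral_smult poly_power minus_diff_commute del: power_Suc of_nat_Suc)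
  then have *: "poly_exp_integral c ?q = (of_real ((1 - b) ^ Suc k) * exp c
      - of_real ((- 1 - b) ^ Suc k) * exp (- c) - of_nat (Suc k) * poly_exp_integral c ([:-b, 1:] ^ k)) / c"
    using assms by (simp add: field_simps)
  define u where "u = (of_real (1 - b) :: complex)"
  define v where "v = (of_real (1 + b) :: complex)"
  have v: "of_real ((- 1 - b) ^ Suc k) = (- v) ^ Suc k"
    unfolding v_def by (simp only: of_real_power of_real_minus [symmetric]) simp
  have u: "of_real ((1 - b) ^ Suc k) = u ^ Suc k"
    unfolding u_def by (rule of_real_power)
  \<comment> \<open>The top summand of a partial sum, times the common prefactor, is a boundary term
    divided by c. It is needed for w = -u at the endpoint 1 and for w = v at -1.\<close>
  have d: "(-1) ^ Suc k * fact (Suc k) / c ^ (Suc k + 1) * ((c * w) ^ Suc k / fact (Suc k)) = (- w) ^ Suc k / c"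
    for w :: complex
    using assms by (simp add: power_mult_distrib power_minus [of w] del: fact_Suc power_Suc)
      (simp add: field_simps)
  \<comment> \<open>\<open>A\<close> and \<open>B\<close> stand for the partial sums of order k,
    which leaves pure algebra.\<close>
  have "(-1) ^ Suc k * fact (Suc k) / c ^ (Suc k + 1) *
      (exp c * (A + (- (c * u)) ^ Suc k / fact (Suc k)) - exp (- c) * (B + (c * v) ^ Suc k / fact (Suc k)))
     = (-1) ^ Suc k * fact (Suc k) / c ^ (Suc k + 1) * (exp c * A - exp (- c) * B)
       + exp c * (u ^ Suc k / c) - exp (- c) * ((- v) ^ Suc k / c)" for A B
  proof -
    have "K * (x * (A + X) - y * (B + Y)) = K * (x * A - y * B) + x * (K * X) - y * (K * Y)"
      for K x y X Y :: complex
      by (simp add: algebra_simps)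
    from this [of _ _ _ _ "(c * v) ^ Suc k / fact (Suc k)"] show ?thesis
      using d [of "- u"] d [of v] by (simp only: mult_minus_right minus_minus)
  qed
  also have "\<dots> A B = (u ^ Suc k * exp c - (- v) ^ Suc k * exp (- c) - of_nat (Suc k) *
      ((-1) ^ k * fact k / c ^ (k + 1) * (exp c * A - exp (- c) * B))) / c" for A B
    using assms by (simp add: diff_divide_distrib add_divide_distrib mult_ac)
  finally show ?case
    unfolding * Suc exp_partial_Suc u v u_def [symmetric] v_def [symmetric] by (simp only:)
qed

text \<open>Each integration by parts splits off one boundary term, divides by c and differentiates
  p; the process ends because the degree drops.\<close>

lemma poly_exp_integral_eq_sum_derivs:
  assumes "c \<noteq> 0" "degree p \<le> n"
  shows "poly_exp_integral c p = (\<Sum>k=0..n. (-1) ^ k *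
    (of_real (poly ((pderiv ^^ k) p) 1) * exp c - of_real (poly ((pderiv ^^ k) p) (-1)) * exp (- c))
    / c ^ (k + 1))"
  using assms(2)
proof (induction n arbitrary: p)
  case 0
  then obtain a where "p = [:a:]"
    by (metis degree_eq_zeroE le_zero_eq)
  then show ?case
    using poly_exp_integral_parts [of c p] assms(1) by (simp add: field_simps pderiv_pCons)
next
  case (Suc n)
  have "degree (pderiv p) \<le> n"
    using Suc.prems by (simp add: degree_pderiv)
  note IH = Suc.IH [OF this]
  have "poly_exp_integral c p = (of_real (poly p 1) * exp c - of_real (poly p (-1)) * exp (- c)
      - poly_exp_integral c (pderiv p)) / c"
    using poly_exp_integral_parts [of c p] assms(1) by (simp add: field_simps)
  then show ?case
    unfolding IH sum.atLeast0_atMost_Suc_shift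
    by (simp add: diff_divide_distrib sum_negf [symmetric] sum_divide_distrib funpow_Suc_right
          mult_ac del: funpow.simps)
qed

text \<open>The hypotheses kill every boundary term, so each derivative moves onto the exponential
  at the cost of a factor -c.\<close>

lemma poly_exp_integral_higher_pderiv:
  assumes "\<And>k. k < n \<Longrightarrow> poly ((pderiv ^^ k) p) 1 = 0" "\<And>k. k < n \<Longrightarrow> poly ((pderiv ^^ k) p) (-1) = 0"
  shows "poly_exp_integral c ((pderiv ^^ n) p) = (- c) ^ n * poly_exp_integral c p"
  using assms
proof (induction n)
  case (Suc n)
  then show ?case
    using poly_exp_integral_parts [of c "(pderiv ^^ n) p"] by simp
qed simp

section \<open>Taylor coefficients of the Legendre polynomials\<close>

lemma higher_pderiv_pcompose_linear:
  "(pderiv ^^ k) (pcompose p [:a, b:]) = smult (b ^ k) (pcompose ((pderiv ^^ k) p) [:a, b:])"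
  for a b :: "'a :: idom"
  by (induction k) (simp_all add: pderiv_smult pderiv_pcompose pderiv_pCons mult_ac)

text \<open>Translation moves the point a to 0, where a k-th derivative is k! times a coefficient.
  Derivatives at the endpoints thus become coefficients of shifted polynomials.\<close>

lemma poly_higher_pderiv:
  "poly ((pderiv ^^ k) p) a = fact k * coeff (pcompose p [:a, 1:]) k" for a :: "'a :: {idom, ring_char_0}"
proof -
  have "poly ((pderiv ^^ k) p) a = coeff ((pderiv ^^ k) (pcompose p [:a, 1:])) 0"
    by (simp add: higher_pderiv_pcompose_linear)
  then show ?thesis
    by (simp add: coeff_higher_pderiv pochhammer_fact)
qed

lemma coeff_linear_power_binomial:
  "coeff ([:a, 1:] ^ n) k = of_nat (n choose k) * a ^ (n - k)" for a :: "'a :: comm_ring_1"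
proof (cases "k \<le> n")
  case True then show ?thesis by (simp add: coeff_linear_poly_power)
next
  case False
  then have "degree ([:a, 1:] ^ n) < k"
    by (simp add: degree_linear_power)
  with False show ?thesis by (simp add: coeff_eq_0 binomial_eq_0)
qed

lemma pcompose_power: "pcompose (p ^ n) q = pcompose p q ^ n" for p q :: "'a :: comm_semiring_1 poly"
  by (induction n) (simp_all add: pcompose_mult pcompose_1)

text \<open>For a root a of x^2 - 1 one has (x + a)^2 - 1 = x (x + 2a). This displays the zero of
  order n at either endpoint together with its cofactor.\<close>

lemma pcompose_rodrigues_shift:
  fixes a :: real
  assumes "a = 1 \<or> a = -1"
  shows "pcompose ([:-1, 0, 1:] ^ n) [:a, 1:] = monom 1 n * [:2 * a, 1:] ^ n"
proof -
  have "[:-1, 0, 1:] \<circ>\<^sub>p [:a, 1:] = [:0, 1:] * [:2 * a, 1:]"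
    using assms by (auto simp: pcompose_pCons)
  then show ?thesis
    by (simp only: pcompose_power power_mult_distrib) (simp add: monom_altdef)
qed

lemma coeff_rodrigues:
  "coeff ([:-1, 0, 1:] ^ n) m =
     (if even m then of_nat (n choose (m div 2)) * (-1) ^ (n - m div 2) else 0 :: real)"
proof -
  have "[:-1, 0, 1:] = monom 1 2 + [:-1 :: real:]"
    by (simp add: monom_altdef power2_eq_square)
  moreover have "[:-1 :: real:] ^ k = [:(-1) ^ k:]" for k
    by (induction k) auto
  ultimately have "[:-1, 0, 1:] ^ n =
      (\<Sum>k\<le>n. monom (of_nat (n choose k) * (-1 :: real) ^ (n - k)) (2 * k))"
    by (simp add: binomial_ring monom_power smult_monom of_nat_poly mult_ac)
  then have "coeff ([:-1, 0, 1:] ^ n) m =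
      (\<Sum>k\<le>n. if 2 * k = m then of_nat (n choose k) * (-1 :: real) ^ (n - k) else 0)"
    by (simp add: coeff_sum)
  \<comment> \<open>Solving \<open>2 * k = m\<close> for k collapses the sum to one term. If m div 2
    exceeds n there is no such term, in agreement with the vanishing binomial coefficient.\<close>
  also have "\<dots> = (\<Sum>k\<le>n. if even m \<and> k = m div 2 then of_nat (n choose k) * (-1 :: real) ^ (n - k) else 0)"
    by (intro sum.cong) auto
  also have "\<dots> = (if even m then of_nat (n choose (m div 2)) * (-1) ^ (n - m div 2) else 0)"
    by (auto simp: binomial_eq_0 not_le)
  finally show ?thesis .
qed

lemma pochhammer_of_nat_Suc:
  "pochhammer (of_nat (Suc k)) n = (fact (n + k) / fact k :: 'a :: field_char_0)"
  using pochhammer_product' [of "1::'a" k n]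
  by (simp add: pochhammer_fact [symmetric] field_simps)

text \<open>Differentiation commutes with translation. The coefficient of x^(n+k) in x^n (x + 2a)^n
  is that of x^k in (x + 2a)^n, and n derivatives multiply it by (n+k)!/k!.\<close>

lemma coeff_legendre_poly_shift:
  fixes a :: real
  assumes "a = 1 \<or> a = -1" "k \<le> n"
  shows "coeff (pcompose (legendre_poly n) [:a, 1:]) k =
    a ^ (n - k) * fact (n + k) / (2 ^ k * fact (n - k) * fact k * fact k)"
proof -
  have "pcompose (legendre_poly n) [:a, 1:] =
      smult (1 / (2 ^ n * fact n)) ((pderiv ^^ n) (pcompose ([:-1, 0, 1:] ^ n) [:a, 1:]))"
    by (simp add: legendre_poly_def pcompose_smult higher_pderiv_pcompose_linear)
  also have "coeff \<dots> k = 1 / (2 ^ n * fact n) * (fact (n + k) / fact k) *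
      (of_nat (n choose k) * (2 * a) ^ (n - k))"
    unfolding pcompose_rodrigues_shift [OF assms(1)] coeff_smult coeff_higher_pderiv
      pochhammer_of_nat_Suc
    by (simp add: coeff_monom_mult coeff_linear_power_binomial)
  also have "\<dots> = a ^ (n - k) * fact (n + k) / (2 ^ k * fact (n - k) * fact k * fact k)"
    using assms(2) by (simp add: binomial_fact power_mult_distrib power_diff field_simps)
  finally show ?thesis .
qed

lemma degree_legendre_poly_le: "degree (legendre_poly n) \<le> n"
proof (rule degree_le, intro allI impI)
  fix i assume "n < i"
  \<comment> \<open>The coefficient of x^i in P_n is a multiple of that of x^(i+n) in (x^2 - 1)^n,
    whose binomial factor vanishes beyond n.\<close>
  then have "n < (i + n) div 2" if "even (i + n)"
    using that by presburger
  then show "coeff (legendre_poly n) i = 0"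
    by (simp add: legendre_poly_def coeff_higher_pderiv coeff_rodrigues binomial_eq_0)
qed

text \<open>For odd n - k both sides vanish: P_n has the parity of n, and (n+k-1)/2 is a natural
  number below n. For n = k + 2j the generalized binomial is a product of half-integers, split at
  the change of sign and evaluated by (1/2)_m = (2m)!/(4^m m!).\<close>

lemma coeff_legendre_poly:
  assumes "k \<le> n"
  shows "coeff (legendre_poly n) k =
    2 ^ n * of_nat (n choose k) * (((real n + real k - 1) / 2) gchoose n)"
proof (cases "even (n - k)")
  case True
  then obtain j where j: "n = k + 2 * j"
    using assms by (metis dvdE le_add_diff_inverse)
  \<comment> \<open>The smallest factor in the numerator of the generalized binomial
    coefficient.\<close>
  have e: "(real n + real k - 1) / 2 - real n + 1 = 1 / 2 - real j"
    by (simp add: j field_simps)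
  have f: "pochhammer (1 / 2) m = (fact (2 * m) / (4 ^ m * fact m) :: real)" for m
  proof -
    have "(2 :: real) ^ (2 * m) = 4 ^ m" by (simp add: power_mult)
    then show ?thesis by (simp add: fact_double)
  qed
  have "pochhammer (1 / 2 - real j) n = pochhammer (1 / 2 - real j) j * pochhammer (1 / 2) (k + j)"
  proof -
    have "n = j + (k + j)" by (simp add: j)
    then show ?thesis
      using pochhammer_product' [of "1 / 2 - real j" j "k + j"] by simp
  qed
  \<comment> \<open>The j negative factors 1/2 - j, ..., -1/2 are the first j positive
    half-integers, reversed and negated.\<close>
  also have "pochhammer (1 / 2 - real j) j = (-1) ^ j * pochhammer (1 / 2) j"
  proof -
    have "- (1 / 2) - real j + 1 = 1 / 2 - real j" by simp
    then show ?thesis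
      using pochhammer_minus' [of "- (1 / 2) :: real" j] by simp
  qed
  finally have g: "((real n + real k - 1) / 2) gchoose n =
      (-1) ^ j * (fact (2 * j) / (4 ^ j * fact j)) * (fact (2 * (k + j)) / (4 ^ (k + j) * fact (k + j))) / fact n"
    unfolding gbinomial_pochhammer' e f by simp
  have c1: "coeff (legendre_poly n) k =
      1 / (2 ^ n * fact n) * (fact (2 * (k + j)) / fact k) * (of_nat (n choose (k + j)) * (-1) ^ j)"
  proof -
    have "k + n = 2 * (k + j)" "n + k = 2 * (k + j)" "n - (k + j) = j" by (simp_all add: j)
    then show ?thesis
      unfolding legendre_poly_def coeff_smult coeff_higher_pderiv pochhammer_of_nat_Suc coeff_rodrigues by simp
  qed
  have c2: "of_nat (n choose (k + j)) = (fact n / (fact (k + j) * fact j) :: real)"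
    by (subst binomial_fact) (auto simp: j)
  have c3: "of_nat (n choose k) = (fact n / (fact k * fact (2 * j)) :: real)"
    by (subst binomial_fact) (auto simp: j)
  have c4: "(4 :: real) ^ (k + j) * 4 ^ j = 2 ^ n * 2 ^ n"
  proof -
    have "(4 :: real) ^ (k + j) * 4 ^ j = (2 * 2) ^ n"
      by (simp add: j power_add mult_2)
    then show ?thesis by (simp only: power_mult_distrib)
  qed
  \<comment> \<open>All factorials and powers become variables here: t = 2^n, N = n!, M = (2j)!, F =
    (2(k+j))!, a = 4^j, b = 4^(k+j). The only relation between them that matters is b a = t^2, which
    is \<open>c4\<close>.\<close>
  have gen: "1 / (t * N) * (F / K) * (N / (L * J) * e) =
      t * (N / (K * M)) * (e * (M / (a * J)) * (F / (b * L)) / N)"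
    if "b * a = t * t" "t \<noteq> 0" "N \<noteq> 0" "M \<noteq> 0" for t N F K L J M e a b :: real
  proof -
    have "t * (N / (K * M)) * (e * (M / (a * J)) * (F / (b * L)) / N) =
        t * t / (b * a) * (1 / t * (F / K) * (e / (L * J)))"
      using that(2-) by (simp add: mult_ac)
    then show ?thesis
      using that by simp
  qed
  show ?thesis
    unfolding g c1 c2 c3 by (rule gen) (simp_all add: c4)
next
  case False
  then obtain j where j: "n = k + 2 * j + 1"
    using assms by (metis add.assoc le_add_diff_inverse oddE)
  have "(real n + real k - 1) / 2 = real (k + j)"
    by (simp add: j)
  then have "((real n + real k - 1) / 2) gchoose n = real ((k + j) choose n)"
    by (simp only: binomial_gbinomial)
  also have "\<dots> = 0"
    by (simp add: j)
  finally have "((real n + real k - 1) / 2) gchoose n = 0" .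
  moreover have "odd (k + n)"
    by (simp add: j)
  ultimately show ?thesis
    by (simp add: legendre_poly_def coeff_higher_pderiv coeff_rodrigues)
qed

section \<open>The first, third and fourth formulas\<close>

text \<open>Taylor expansion of p around b, integrated term by term.\<close>

lemma poly_exp_integral_expansion:
  assumes "degree p \<le> n"
  shows "poly_exp_integral c p =
    (\<Sum>k=0..n. of_real (coeff (pcompose p [:b, 1:]) k) * poly_exp_integral c ([:-b, 1:] ^ k))"
proof -
  let ?q = "pcompose p [:b, 1:]"
  have "degree ?q \<le> n"
    using degree_pcompose_le [of p "[:b, 1:]"] assms by simp
  have "poly p x = poly (\<Sum>k=0..n. smult (coeff ?q k) ([:-b, 1:] ^ k)) x" for x
  proof -
    have "poly p x = poly ?q (x - b)"
      by (simp add: poly_pcompose)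
    also have "\<dots> = (\<Sum>k=0..n. coeff ?q k * (x - b) ^ k)"
      unfolding poly_altdef using \<open>degree ?q \<le> n\<close>
      by (intro sum.mono_neutral_left) (auto simp: coeff_eq_0)
    finally show ?thesis
      by (simp add: poly_sum poly_power)
  qed
  then have "p = (\<Sum>k=0..n. smult (coeff ?q k) ([:-b, 1:] ^ k))"
    by (simp add: poly_eq_poly_eq_iff [symmetric] fun_eq_iff)
  from arg_cong [OF this, of "poly_exp_integral c"] show ?thesis
    by (simp add: poly_exp_integral_sum poly_exp_integral_smult)
qed

lemma legendre_hat_eq_poly_exp_integral: "legendre_hat n z = poly_exp_integral (\<i> * z) (legendre_poly n)"
  by (simp add: legendre_hat_def poly_exp_integral_def)

lemma legendre_hat_expansion_0:
  assumes "z \<noteq> 0"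
  shows "legendre_hat n z =
       2 ^ n * (\<Sum>k=0..n. of_nat (n choose k)
          * complex_of_real (((real n + real k - 1) / 2) gchoose n)
          * ((-1) ^ k * fact k / (\<i> * z) ^ (k + 1))
          * (exp (\<i> * z) * exp_partial k (- (\<i> * z)) - exp (- (\<i> * z)) * exp_partial k (\<i> * z)))"
proof -
  have "\<i> * z \<noteq> 0" using assms by simp
  note M = poly_exp_integral_shifted_power [OF this, of 0]
  show ?thesis
    unfolding legendre_hat_eq_poly_exp_integral
      poly_exp_integral_expansion [OF degree_legendre_poly_le, of _ _ 0] M sum_distrib_left
    by (intro sum.cong) (simp_all add: coeff_legendre_poly mult_ac)
qed

text \<open>Expanding around b = 1 makes the argument 1 - b vanish, so the partial sum attached to
  exp c is 1 and only the one at 2c survives.\<close>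

lemma legendre_hat_expansion_1:
  assumes "z \<noteq> 0"
  shows "legendre_hat n z =
       2 * (\<Sum>k=0..n. fact (n + k) / (fact (n - k) * fact k)
          * ((exp (- (\<i> * z)) * exp_partial k (2 * \<i> * z) - exp (\<i> * z)) / (- 2 * \<i> * z) ^ (k + 1)))"
proof -
  define c where "c = \<i> * z"
  have "c \<noteq> 0" using assms by (simp add: c_def)
  note M = poly_exp_integral_shifted_power [OF this, of 1]
  have e0: "exp_partial k 0 = 1" for k
    by (induction k) (simp_all add: exp_partial_Suc)
  have c2: "2 * \<i> * z = 2 * c" "- 2 * \<i> * z = (- 2) * c"
    by (simp_all add: c_def)
  show ?thesis
    unfolding legendre_hat_eq_poly_exp_integral c_def [symmetric] c2
      poly_exp_integral_expansion [OF degree_legendre_poly_le, of _ _ 1] M sum_distrib_left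
  proof (intro sum.cong refl)
    fix k assume "k \<in> {0..n}"
    then have C: "coeff (pcompose (legendre_poly n) [:1, 1:]) k =
        fact (n + k) / (2 ^ k * fact (n - k) * fact k * fact k)"
      by (subst coeff_legendre_poly_shift) auto
    define E where "E = exp_partial k (2 * c)"
    have E: "exp_partial k (c * of_real (1 + 1)) = E"
      by (simp add: E_def mult.commute)
    \<comment> \<open>The power absorbs 2^k from the Taylor coefficient and (-1)^k from the moment;
      the remaining -2 accounts for the outer factor 2 and the reversed order of the
      bracket.\<close>
    have P: "((- 2) * c) ^ (k + 1) = - 2 * (-1) ^ k * 2 ^ k * (c ^ (k + 1))"
      by (simp only: power_mult_distrib) (simp add: power_minus [of 2])
    show "complex_of_real (coeff (pcompose (legendre_poly n) [:1, 1:]) k) *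
        ((-1) ^ k * fact k / c ^ (k + 1) *
         (exp c * exp_partial k (- (c * of_real (1 - 1))) - exp (- c) * exp_partial k (c * of_real (1 + 1)))) =
      2 * (fact (n + k) / (fact (n - k) * fact k)
          * ((exp (- c) * exp_partial k (2 * c) - exp c) / ((- 2) * c) ^ (k + 1)))"
      unfolding C E E_def [symmetric] P using \<open>c \<noteq> 0\<close>
      by (cases "even k") (simp_all add: e0 divide_simps, simp_all add: algebra_simps)
  qed
qed

text \<open>The derivatives at 1 and -1 are k! times the shifted coefficients and differ by the sign
  (-1)^(n-k) = (-1)^(n+k).\<close>

lemma legendre_hat_endpoints:
  assumes "z \<noteq> 0"
  shows "legendre_hat n z =
       2 * (\<Sum>k=0..n. fact (n + k) / (fact (n - k) * fact k)
          * (((-1) ^ (n + k) * exp (- (\<i> * z)) - exp (\<i> * z)) / (- 2 * \<i> * z) ^ (k + 1)))"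
proof -
  define c where "c = \<i> * z"
  have "c \<noteq> 0" using assms by (simp add: c_def)
  note M = poly_exp_integral_eq_sum_derivs [OF this degree_legendre_poly_le]
  have c2: "- 2 * \<i> * z = (- 2) * c"
    by (simp add: c_def)
  show ?thesis
    unfolding legendre_hat_eq_poly_exp_integral c_def [symmetric] c2 M sum_distrib_left
  proof (intro sum.cong refl)
    fix k assume "k \<in> {0..n}"
    then have C: "poly ((pderiv ^^ k) (legendre_poly n)) a =
        a ^ (n - k) * (fact (n + k) / (2 ^ k * fact (n - k) * fact k))" if "a = 1 \<or> a = -1" for a
      unfolding poly_higher_pderiv using that by (subst coeff_legendre_poly_shift) auto
    have s: "(-1 :: real) ^ (n - k) = (-1) ^ (n + k)"
      using \<open>k \<in> {0..n}\<close> by (simp add: minus_one_power_iff)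
    have P: "((- 2) * c) ^ (k + 1) = - 2 * (-1) ^ k * 2 ^ k * (c ^ (k + 1))"
      by (simp only: power_mult_distrib) (simp add: power_minus [of 2])
    show "(-1) ^ k * (of_real (poly ((pderiv ^^ k) (legendre_poly n)) 1) * exp c -
         of_real (poly ((pderiv ^^ k) (legendre_poly n)) (-1)) * exp (- c)) / c ^ (k + 1) =
      2 * (fact (n + k) / (fact (n - k) * fact k)
          * (((-1) ^ (n + k) * exp (- c) - exp c) / ((- 2) * c) ^ (k + 1)))"
      unfolding C [of 1, simplified] C [of "-1", simplified] s P using \<open>c \<noteq> 0\<close>
      by (cases "even k") (simp_all add: divide_simps, simp_all add: algebra_simps)
  qed
qed

section \<open>Power series and the Bessel formula\<close>

text \<open>On [-1, 1] the terms of p(x) exp(c x) are dominated by B |c|^m / m! with B a bound for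
  |p|. The Weierstrass test gives uniform convergence, which allows termwise integration.\<close>

lemma poly_exp_integral_sums:
  "(\<lambda>m. c ^ m / fact m * of_real (integral {-1..1} (\<lambda>x. poly p x * x ^ m))) sums poly_exp_integral c p"
proof -
  define f where "f m x = complex_of_real (poly p x) * ((c * of_real x) ^ m / fact m)" for m x
  have cont: "continuous_on {-1..1} (poly p)"
    by (intro continuous_intros)
  then have "compact (poly p ` {-1..1})"
    by (intro compact_continuous_image) auto
  then obtain B where B: "\<And>x. x \<in> {-1..1} \<Longrightarrow> \<bar>poly p x\<bar> \<le> B"
    using compact_imp_bounded bounded_iff by (metis imageI real_norm_def)
  have "norm (f m x) \<le> B * (norm c ^ m / fact m)" if "x \<in> {-1..1}" for m x
  proof -
    have "norm (f m x) = \<bar>poly p x\<bar> * (norm c ^ m * \<bar>x\<bar> ^ m / fact m)"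
      by (simp add: f_def norm_mult norm_divide norm_power power_mult_distrib)
    also have "\<dots> \<le> B * (norm c ^ m * 1 / fact m)"
      using B [OF that] that by (intro mult_mono divide_right_mono mult_left_mono power_le_one) auto
    finally show ?thesis by simp
  qed
  moreover have "summable (\<lambda>m. B * (norm c ^ m / fact m))"
    using summable_exp [of "norm c"] by (intro summable_mult) (simp add: divide_inverse mult.commute)
  ultimately have unif: "uniform_limit {-1..1} (\<lambda>N x. \<Sum>m<N. f m x) (\<lambda>x. \<Sum>m. f m x) sequentially"
    by (intro Weierstrass_m_test) auto
  have suminf: "(\<Sum>m. f m x) = of_real (poly p x) * exp (c * of_real x)" for x
    using sums_mult [OF exp_converges [of "c * of_real x"], of "of_real (poly p x)"]
    by (simp add: f_def scaleR_conv_of_real divide_inverse mult.commute mult.left_commute sums_iff)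
  have cf: "continuous_on {-1..1} (\<lambda>x. \<Sum>m<N. f m x)" for N
    unfolding f_def by (intro continuous_intros) auto
  obtain I J where I: "\<And>N. ((\<lambda>x. \<Sum>m<N. f m x) has_integral I N) {-1..1}"
    and J: "((\<lambda>x. \<Sum>m. f m x) has_integral J) {-1..1}" and lim: "I \<longlonglongrightarrow> J"
    using uniform_limit_integral [OF unif cf] by auto
  have fint: "(f m has_integral c ^ m / fact m * of_real (integral {-1..1} (\<lambda>x. poly p x * x ^ m))) {-1..1}"
    for m
  proof -
    have "(\<lambda>x. poly p x * x ^ m) integrable_on {-1..1}"
      by (intro integrable_continuous_interval continuous_intros)
    from has_integral_of_real [OF integrable_integral [OF this]]
    have "((\<lambda>x. c ^ m / fact m * complex_of_real (poly p x * x ^ m)) has_integral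
        c ^ m / fact m * of_real (integral {-1..1} (\<lambda>x. poly p x * x ^ m))) {-1..1}"
      by (rule has_integral_mult_right)
    then show ?thesis
      by (simp add: f_def [abs_def] power_mult_distrib mult_ac)
  qed
  have "I = (\<lambda>N. \<Sum>m<N. c ^ m / fact m * of_real (integral {-1..1} (\<lambda>x. poly p x * x ^ m)))"
    by (rule ext, rule has_integral_unique [OF I has_integral_sum]; intro fint finite_lessThan)
  moreover have "J = poly_exp_integral c p"
    using J unfolding suminf poly_exp_integral_def by (simp add: integral_unique)
  ultimately show ?thesis
    using lim by (simp only: sums_def)
qed

lemma Gamma_plus1_pos: "x > 0 \<Longrightarrow> Gamma (x + 1) = x * Gamma x" for x :: real
  by (rule Gamma_plus1) (auto elim!: nonpos_Ints_cases)

text \<open>The even case is the Beta value B((m+1)/2, n+1). Writing one factor 1 - x^2 as a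
  difference reduces n + 1 to n with exponents m and m + 2, hence the induction for all m at once;
  the Gamma recurrence combines the two values.\<close>

lemma has_integral_beta_moment:
  "((\<lambda>x::real. (1 - x\<^sup>2) ^ n * x ^ m) has_integral
     (if even m then Gamma ((real m + 1) / 2) * fact n / Gamma ((real m + 1) / 2 + real n + 1) else 0)) {-1..1}"
proof (induction n arbitrary: m)
  case 0
  have *: "((\<lambda>x. x ^ m) has_integral 1 ^ Suc m / real (Suc m) - (-1) ^ Suc m / real (Suc m)) {-1..1::real}"
    by (intro fundamental_theorem_of_calculus)
      (auto simp: has_real_derivative_iff_has_vector_derivative [symmetric] simp del: power_Suc of_nat_Suc
            intro!: derivative_eq_intros)
  have G: "Gamma ((real m + 1) / 2 + 1) = (real m + 1) / 2 * Gamma ((real m + 1) / 2)"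
    by (rule Gamma_plus1_pos) simp
  have "Gamma ((real m + 1) / 2) \<noteq> 0"
    by (rule less_imp_neq [OF Gamma_real_pos, symmetric]) simp
  then have "Gamma ((real m + 1) / 2) / Gamma ((real m + 1) / 2 + 1) = 2 / (real m + 1)"
    unfolding G by simp
  with * show ?case
    by (cases "even m") (simp_all add: add_ac)
next
  case (Suc n)
  define g where "g = (real m + 1) / 2"
  have "g > 0" by (simp add: g_def)
  have g': "(real (m + 2) + 1) / 2 = g + 1" by (simp add: g_def field_simps)
  have "Gamma (g + real n + 1) > 0" "Gamma g > 0"
    using \<open>g > 0\<close> by (auto intro!: Gamma_real_pos add_pos_nonneg)
  moreover have "g + 1 + real n + 1 = (g + real n + 1) + 1" "g + real (Suc n) + 1 = (g + real n + 1) + 1"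
    by simp_all
  moreover have "Gamma (g + 1) = g * Gamma g"
    "Gamma ((g + real n + 1) + 1) = (g + real n + 1) * Gamma (g + real n + 1)"
    using \<open>g > 0\<close> by (intro Gamma_plus1_pos add_pos_nonneg; simp)+
  ultimately have "Gamma g * fact n / Gamma (g + real n + 1) - Gamma (g + 1) * fact n / Gamma (g + 1 + real n + 1)
      = Gamma g * fact (Suc n) / Gamma (g + real (Suc n) + 1)"
    using \<open>g > 0\<close> by (simp only:) (simp add: divide_simps add_pos_nonneg, simp add: algebra_simps)
  moreover have "(1 - x\<^sup>2) ^ n * x ^ m - (1 - x\<^sup>2) ^ n * x ^ (m + 2) = (1 - x\<^sup>2) ^ Suc n * x ^ m" for x :: real
    by (simp add: algebra_simps power2_eq_square)
  ultimately show ?case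
    using has_integral_diff [OF Suc.IH [of m] Suc.IH [of "m + 2"]]
    unfolding g' g_def [symmetric] by (cases "even m") simp_all
qed

text \<open>A half-integer case of the duplication formula; it cancels the (2k)! of the exponential
  series. Each step multiplies both sides by 1/(4(k+1)).\<close>

lemma Gamma_half_over_fact_double:
  "Gamma (real k + 1 / 2) / fact (2 * k) = sqrt pi / (4 ^ k * fact k)"
proof (induction k)
  case 0
  show ?case by (simp add: Gamma_one_half_real)
next
  case (Suc k)
  have "Gamma (real (Suc k) + 1 / 2) = (real k + 1 / 2) * Gamma (real k + 1 / 2)"
    using Gamma_plus1_pos [of "real k + 1 / 2"] by (simp add: add_ac)
  moreover have "fact (2 * Suc k) = (2 * real k + 2) * (2 * real k + 1) * fact (2 * k)"
    by (simp add: algebra_simps)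
  moreover have "((real k + 1 / 2) * A) / ((2 * real k + 2) * (2 * real k + 1) * F) =
      A / F / (4 * (real k + 1))" if "F > 0" for A F
    using that by (simp add: divide_simps) (simp add: algebra_simps)
  ultimately have "Gamma (real (Suc k) + 1 / 2) / fact (2 * Suc k) =
      Gamma (real k + 1 / 2) / fact (2 * k) / (4 * (real k + 1))"
    by (simp only: fact_gt_zero)
  also have "\<dots> = sqrt pi / (4 ^ Suc k * fact (Suc k))"
    unfolding Suc by (simp add: field_simps)
  finally show ?case .
qed

text \<open>By the Rodrigues formula and n integrations by parts, the transform is (-c)^n/(2^n n!)
  times the integral of (x^2 - 1)^n exp(c x). Its even moments give the Bessel terms; the branch
  factor is left out, so no square root is involved yet.\<close>

lemma legendre_hat_sums:
  "(\<lambda>k. (\<i> * z) ^ n * of_real (sqrt pi) / 2 ^ n *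
      ((-1) ^ k * (z / 2) ^ (2 * k) / (fact k * Gamma (of_nat k + (of_nat n + 1 / 2) + 1)))) sums legendre_hat n z"
proof -
  let ?q = "[:-1, 0, 1:] ^ n :: real poly"
  define c where "c = \<i> * z"
  \<comment> \<open>The shifted polynomial is divisible by x^n, so its coefficients below n are
    zero.\<close>
  have vanish: "poly ((pderiv ^^ k) ?q) a = 0" if "k < n" "a = 1 \<or> a = -1" for k a
    unfolding poly_higher_pderiv pcompose_rodrigues_shift [OF that(2)] using that(1)
    by (simp add: coeff_monom_mult)
  have hat: "legendre_hat n z = 1 / (2 ^ n * fact n) * (- c) ^ n * poly_exp_integral c ?q"
    using poly_exp_integral_higher_pderiv [of n ?q c] vanish
    by (simp add: legendre_hat_eq_poly_exp_integral legendre_poly_def poly_exp_integral_smult c_def)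
  have mom: "integral {-1..1} (\<lambda>x. poly ?q x * x ^ m) =
      (if even m then (-1) ^ n * (Gamma ((real m + 1) / 2) * fact n / Gamma ((real m + 1) / 2 + real n + 1)) else 0)"
    for m
  proof -
    have "poly ?q x * x ^ m = (-1) ^ n * ((1 - x\<^sup>2) ^ n * x ^ m)" for x
    proof -
      have "poly ?q x = (- (1 - x\<^sup>2)) ^ n" by (simp add: poly_power power2_eq_square)
      then show ?thesis by (simp add: power_minus [of "1 - x\<^sup>2"] del: minus_diff_eq)
    qed
    then show ?thesis
      using integral_unique [OF has_integral_mult_right [OF has_integral_beta_moment [of n m], of "(-1) ^ n"]]
      by (simp only: mult_zero_right if_distrib)
  qed
  \<comment> \<open>Odd moments vanish, so the series may be reindexed along the even
    numbers.\<close>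
  have "(\<lambda>k. c ^ (2 * k) / fact (2 * k) * of_real (integral {-1..1} (\<lambda>x. poly ?q x * x ^ (2 * k))))
      sums poly_exp_integral c ?q"
  proof (subst sums_mono_reindex [of "\<lambda>k. 2 * k"])
    fix m assume "m \<notin> range (\<lambda>k::nat. 2 * k)"
    then have "odd m" by auto
    then show "c ^ m / fact m * of_real (integral {-1..1} (\<lambda>x. poly ?q x * x ^ m)) = 0"
      by (simp only: mom) simp
  qed (simp add: strict_mono_def, rule poly_exp_integral_sums)
  from sums_mult [OF this, of "1 / (2 ^ n * fact n) * (- c) ^ n"]
  have "(\<lambda>k. 1 / (2 ^ n * fact n) * (- c) ^ n *
      (c ^ (2 * k) / fact (2 * k) * of_real (integral {-1..1} (\<lambda>x. poly ?q x * x ^ (2 * k))))) sums legendre_hat n z"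
    by (simp only: hat)
  also have "(\<lambda>k. 1 / (2 ^ n * fact n) * (- c) ^ n *
      (c ^ (2 * k) / fact (2 * k) * of_real (integral {-1..1} (\<lambda>x. poly ?q x * x ^ (2 * k))))) =
    (\<lambda>k. (\<i> * z) ^ n * of_real (sqrt pi) / 2 ^ n *
      ((-1) ^ k * (z / 2) ^ (2 * k) / (fact k * Gamma (of_nat k + (of_nat n + 1 / 2) + 1))))"
  proof
    fix k
    define G where "G = Gamma (real k + 1 / 2 + real n + 1)"
    have "G > 0" by (auto simp: G_def intro!: Gamma_real_pos add_pos_nonneg)
    have h: "(real (2 * k) + 1) / 2 = real k + 1 / 2" by simp
    have GC: "Gamma (of_nat k + (of_nat n + 1 / 2) + 1) = complex_of_real G"
      unfolding G_def Gamma_complex_of_real [symmetric] by (simp add: add_ac)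
    have I: "of_real (integral {-1..1} (\<lambda>x. poly ?q x * x ^ (2 * k))) =
       ((-1) ^ n * fact n * (fact (2 * k) * (of_real (sqrt pi) / (4 ^ k * fact k))) / of_real G :: complex)"
    proof -
      have "Gamma (real k + 1 / 2) = fact (2 * k) * (sqrt pi / (4 ^ k * fact k))"
        using Gamma_half_over_fact_double [of k] by (simp add: field_simps)
      then show ?thesis
        unfolding mom h G_def [symmetric] by simp
    qed
    have s: "(-1) ^ n * (- c) ^ n = c ^ n"
      by (simp add: power_mult_distrib [symmetric])
    \<comment> \<open>The alternating sign comes from c^2 = -z^2, and the 4^k of the duplication
      formula turns z into z/2.\<close>
    have q: "c ^ (2 * k) / 4 ^ k = (-1) ^ k * (z / 2) ^ (2 * k)"
      by (simp add: c_def power_mult power_divide power_mult_distrib power_minus [of "z\<^sup>2"])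
    have "1 / (2 ^ n * fact n) * (- c) ^ n * (c ^ (2 * k) / fact (2 * k) *
        of_real (integral {-1..1} (\<lambda>x. poly ?q x * x ^ (2 * k)))) =
      ((-1) ^ n * (- c) ^ n) * of_real (sqrt pi) / 2 ^ n * ((c ^ (2 * k) / 4 ^ k) / (fact k * of_real G))"
      unfolding I using \<open>G > 0\<close> by (simp add: field_simps)
    then show "1 / (2 ^ n * fact n) * (- c) ^ n * (c ^ (2 * k) / fact (2 * k) *
        of_real (integral {-1..1} (\<lambda>x. poly ?q x * x ^ (2 * k)))) =
      (\<i> * z) ^ n * of_real (sqrt pi) / 2 ^ n *
      ((-1) ^ k * (z / 2) ^ (2 * k) / (fact k * Gamma (of_nat k + (of_nat n + 1 / 2) + 1)))"
      unfolding s q GC by (simp only: c_def)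
  qed
  finally show ?thesis .
qed

text \<open>The root s in the branch factor cancels against the one under sqrt(2 pi), leaving
  sqrt(pi)/2^n; hence either square root gives the same value.\<close>

lemma legendre_hat_bessel:
  assumes "z \<noteq> 0" "s\<^sup>2 = z"
  shows "legendre_hat n z = \<i> ^ n * (complex_of_real (sqrt (2 * pi)) / s) * bessel_J_half n s z"
proof -
  define t where "t k = (-1) ^ k * (z / 2) ^ (2 * k) / (fact k * Gamma (of_nat k + (of_nat n + 1 / 2) + 1))" for k
  define C where "C = \<i> ^ n * (complex_of_real (sqrt (2 * pi)) / s)"
  define w where "w = z ^ n * s / complex_of_real (2 powr (real n + 1 / 2))"
  have "s \<noteq> 0" using assms by auto
  then have "C \<noteq> 0" by (simp add: C_def)
  have "2 powr (real n + 1 / 2) = 2 ^ n * sqrt 2"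
    by (simp add: powr_add powr_realpow powr_half_sqrt)
  then have "C * w = (\<i> * z) ^ n * of_real (sqrt pi) / 2 ^ n"
    using \<open>s \<noteq> 0\<close> by (simp add: C_def w_def real_sqrt_mult power_mult_distrib field_simps)
  then have "(\<lambda>k. C * (w * t k)) sums legendre_hat n z"
    using legendre_hat_sums [of z n] by (simp add: t_def mult.assoc [symmetric])
  \<comment> \<open>Dividing a series already known to converge by \<open>C\<close> also yields the
    convergence of the Bessel series.\<close>
  from sums_divide [OF this, of C] have "(\<lambda>k. w * t k) sums (legendre_hat n z / C)"
    using \<open>C \<noteq> 0\<close> by simp
  moreover have "bessel_J_half n s z = (\<Sum>k. w * t k)"
    unfolding bessel_J_half_def bessel_J_branch_def w_def [symmetric] t_def
    by (simp add: mult.left_commute)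
  ultimately have "bessel_J_half n s z = legendre_hat n z / C"
    by (simp only: sums_iff)
  then show ?thesis
    using \<open>C \<noteq> 0\<close> by (simp add: C_def)
qed

theorem theorem2p1:
  fixes n :: nat and z :: complex
  assumes "z \<noteq> 0"
  shows
    "legendre_hat n z =
       2 ^ n * (\<Sum>k=0..n. of_nat (n choose k)
          * complex_of_real (((real n + real k - 1) / 2) gchoose n)
          * ((-1) ^ k * fact k / (\<i> * z) ^ (k + 1))
          * (exp (\<i> * z) * exp_partial k (- (\<i> * z)) - exp (- (\<i> * z)) * exp_partial k (\<i> * z)))
     \<and> (\<forall>s. s\<^sup>2 = z \<longrightarrow>
          legendre_hat n z = \<i> ^ n * (complex_of_real (sqrt (2 * pi)) / s) * bessel_J_half n s z)
     \<and> legendre_hat n z =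
       2 * (\<Sum>k=0..n. fact (n + k) / (fact (n - k) * fact k)
          * ((exp (- (\<i> * z)) * exp_partial k (2 * \<i> * z) - exp (\<i> * z)) / (- 2 * \<i> * z) ^ (k + 1)))
     \<and> legendre_hat n z =
       2 * (\<Sum>k=0..n. fact (n + k) / (fact (n - k) * fact k)
          * (((-1) ^ (n + k) * exp (- (\<i> * z)) - exp (\<i> * z)) / (- 2 * \<i> * z) ^ (k + 1)))"
  using assms legendre_hat_expansion_0 legendre_hat_bessel legendre_hat_expansion_1 legendre_hat_endpoints
  by blast

end
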